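(* Consider the chance constrained stochastic optimal control problem (P) described in the context, and let $\boldsymbol\pi'$ be a feasible solution to the sample-approximated form of problem (P) for a given $\beta_{\mathrm{cor}}$, where $\beta_{\mathrm{cor}}>\beta$ is chosen such that $$1-\mathrm{betainv}\Bigl(1-\tfrac{\alpha}{2},\;N_S+1-\lfloor\beta_{\mathrm{cor}}N_S\rfloor,\;\lfloor\beta_{\mathrm{cor}}N_S\rfloor\Bigr)\ \ge\ \beta .$$ Then $\boldsymbol\pi'$ is a feasible point of (P) with probability not less than $1-\alpha$.
   Context: Data. $\beta\in(0,1]$ is the required satisfaction probability, $\alpha\in(0,1)$, and $N_S$ is the number of samples. Problem (P): on the horizon $[t_k,t_f]$, $$\min_{\boldsymbol\pi}\ J(\overline{\boldsymbol x}(\cdot),\overline{\boldsymbol u}(\cdot))$$ subject to - $\dot{\overline{\boldsymbol x}}(t)=\boldsymbol f(\overline{\boldsymbol x}(t),\overline{\boldsymbol u}(t,\boldsymbol\pi),\boldsymbol p)$ for all $t\in[t_k,t_f]$, - $\mathbb P[\boldsymbol g(\boldsymbol X)\le\boldsymbol0]\ge\beta$, - $\overline{\boldsymbol u}(t,\boldsymbol\pi)\in\mathcal U$ for all $t\in[t_k,t_f]$, - $\overline x_i(t_k)\sim\mu_{x_i(t_k)}$, $i=1,\dots,n_x$, - $p_i\sim\mu_{p_i}$, $i=1,\dots,n_p$. Here $\boldsymbol\pi\in\mathbb R^{n_\pi}$ is the decision vector parametrizing the input $\overline{\boldsymbol u}(t,\boldsymbol\pi)$; $\mathcal U\subset\mathbb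 R^{n_u}$ is compact; $\overline{\boldsymbol x}$ are the predicted states; $\boldsymbol p$ are time-invariant uncertain parameters; $\mu_{x_i(t_k)}$ and $\mu_{p_i}$ are given probability distributions of the initial states and parameters (uncorrelated, with finite variances); $J$ is a deterministic cost depending on the input and on moments of the predicted states; $\boldsymbol X$ is the stacked vector of states at constraint time points $t_{x,1},\dots,t_{x,N_x}\in[t_k,t_f]$; and $\boldsymbol g=(g_1,\dots,g_{N_g})$ are the constraint functions (inequalities are componentwise). Polynomial chaos expansion. The uncertain parameters and initial states are functions of a random vector $\boldsymbol\xi=(\xi_1,\dots,\xi_{n_\xi})$ with independent components. The dynamics and chance constraint are considered for the polynomial-chaos-expanded system rather than for the original nonlinear system: states are represented as $x_i(t,\boldsymbol\xi)=\widetilde{\boldsymbol x}_i(t)^\top\boldsymbol\Psi(\boldsymbol\xi)$, where $\boldsymbol\Psi(\boldsymbol\xi)$ is a vector of multivariate orthogonal polynomials and the deterministic coefficient vectors $\widetilde{\boldsymbol x}_i(t)$ solve a system of ordinary differential equations $$\dot{\widetilde{\boldsymbol x}}_i(t)=\widetilde{\boldsymbol f}_i(\widetilde{\boldsymbol x}_1(t),\dots,\widetilde{\boldsymbol x}_{n_x}(t),\overline{\boldsymbol u}(t,\boldsymbol\pi),\widetilde{\boldsymbol p}_1,\dots,\widetilde{\boldsymbol p}_{n_p}),\quad i=1,\dots,n_x,$$ obtained by Galerkin projection, with $\widetilde{\boldsymbol p}_i$ the expansion coefficients of the parameters and initial coefficients $\widetilde{\boldsymbol x}_i(t_k)$ obtained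 by projecting the initial states. With $\widetilde{\boldsymbol X}$ the stacked vector of all $\widetilde{\boldsymbol x}_i(t_{x,l})$, the chance constraint reads $\mathbb P[\boldsymbol g(\widetilde{\boldsymbol X},\boldsymbol\xi)\le\boldsymbol0]\ge\beta$. Sample-approximated form of (P): the problem in which the chance constraint is replaced by the sample approximation of the tightened chance constraint $\mathbb P[\boldsymbol g(\widetilde{\boldsymbol X},\boldsymbol\xi)\le\boldsymbol0]\ge\beta_{\mathrm{cor}}$, namely $$\frac1{N_S}\sum_{j=1}^{N_S}I_{\mathcal G}(\boldsymbol\xi^{[j]})\ge\beta_{\mathrm{cor}},\qquad \mathcal G:=\{\boldsymbol\xi\in\mathbb R^{n_\xi}: g_i(\widetilde{\boldsymbol X},\boldsymbol\xi)\le0\ \forall i=1,\dots,N_g\},$$ where $\boldsymbol\xi^{[1]},\dots,\boldsymbol\xi^{[N_S]}$ are independent and identically distributed samples of $\boldsymbol\xi$ and $I_{\mathcal G}$ is the indicator function of $\mathcal G$; the cost function may also be sample-approximated, and all other constraints are unchanged. $\boldsymbol\pi'$ is a solution found by this sample approximation. The probability with which $\boldsymbol\pi'$ is feasible for (P) is also called the feasibility probability, or confidence level of feasibility. Notation. $\lfloor\cdot\rfloor$ denotes rounding towards $-\infty$; $\mathrm{betainv}(q,a,b)$ is the inverse of the cumulative distribution function of the Beta distribution with parameters $a,b$, evaluated at $q$.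
   Formalization: The point π' is fixed before the samples are drawn, as the claim fails for π' chosen from them; proved: with probability at least 1−α over the samples, if π' is feasible for the sampled problem then it is feasible for (P). Also ⌊β_cor N_S⌋>0 is assumed so that betainv is defined. *)

theory Defs
  imports "HOL-Probability.Probability"
begin

section \<open>The inverse of the Beta cumulative distribution function\<close>

definition beta_density :: "real \<Rightarrow> real \<Rightarrow> real \<Rightarrow> real" where
  "beta_density a b x =
     (if 0 < x \<and> x < 1 then x powr (a - 1) * (1 - x) powr (b - 1) / Beta a b else 0)"

definition beta_distribution :: "real \<Rightarrow> real \<Rightarrow> real measure" where
  "beta_distribution a b = density lborel (\<lambda>x. ennreal (beta_density a b x))"

text \<open>Meaningful for \<open>a > 0\<close>, \<open>b > 0\<close> and \<open>0 \<le> q \<le> 1\<close>; in that range the distribution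
  function is a bijection of the unit interval.\<close>

definition betainv :: "real \<Rightarrow> real \<Rightarrow> real \<Rightarrow> real" where
  "betainv q a b = the_inv_into {0..1} (cdf (beta_distribution a b)) q"


section \<open>Optimization problems\<close>

record 'v opt_problem =
  objective :: "'v \<Rightarrow> real"
  feasible_set :: "'v set"


section \<open>Problem data\<close>

text \<open>The index types stand for: \<open>'x\<close> states, \<open>'u\<close> inputs, \<open>'p\<close> uncertain parameters,
  \<open>'d\<close> components of the decision vector, \<open>'r\<close> components of the random vector \<open>\<xi>\<close>,
  \<open>'b\<close> polynomials in the expansion, \<open>'t\<close> constraint time points, \<open>'g\<close> constraint functions.
  Initial states and parameters are the functions \<open>init_state\<close> and \<open>param\<close> of \<open>\<xi>\<close>.
  The cost depends on the input trajectory and on the moments of the predicted states, where a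
  moment is addressed by a multi-index \<open>'x \<Rightarrow> nat\<close> and a time.\<close>

record ('x, 'u, 'p, 'd, 'r, 'b, 't, 'g) pce_ocp =
  t_init :: real
  t_final :: real
  dynamics :: "real ^ 'x \<Rightarrow> real ^ 'u \<Rightarrow> real ^ 'p \<Rightarrow> real ^ 'x"
  input :: "real \<Rightarrow> real ^ 'd \<Rightarrow> real ^ 'u"
  input_set :: "(real ^ 'u) set"
  xi_law :: "(real ^ 'r) measure"
  init_state :: "real ^ 'r \<Rightarrow> real ^ 'x"
  param :: "real ^ 'r \<Rightarrow> real ^ 'p"
  init_law :: "'x \<Rightarrow> real measure"
  param_law :: "'p \<Rightarrow> real measure"
  pce_basis :: "real ^ 'r \<Rightarrow> real ^ 'b"
  constraint_time :: "'t \<Rightarrow> real"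
  constraint_fun :: "real ^ 'x ^ 't \<Rightarrow> real ^ 'g"
  cost :: "(real \<Rightarrow> real ^ 'u) \<Rightarrow> (('x \<Rightarrow> nat) \<Rightarrow> real \<Rightarrow> real) \<Rightarrow> real"

definition uncertain_quantity ::
  "('x::finite, 'u::finite, 'p::finite, 'd::finite, 'r::finite, 'b::finite, 't::finite, 'g::finite) pce_ocp
    \<Rightarrow> 'x + 'p \<Rightarrow> real ^ 'r \<Rightarrow> real" where
  "uncertain_quantity P q \<xi> =
     (case q of Inl i \<Rightarrow> init_state P \<xi> $ i | Inr i \<Rightarrow> param P \<xi> $ i)"

definition uncertain_law ::
  "('x::finite, 'u::finite, 'p::finite, 'd::finite, 'r::finite, 'b::finite, 't::finite, 'g::finite) pce_ocp
    \<Rightarrow> 'x + 'p \<Rightarrow> real measure" where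
  "uncertain_law P q = (case q of Inl i \<Rightarrow> init_law P i | Inr i \<Rightarrow> param_law P i)"

definition valid_data ::
  "('x::finite, 'u::finite, 'p::finite, 'd::finite, 'r::finite, 'b::finite, 't::finite, 'g::finite) pce_ocp
    \<Rightarrow> bool" where
  "valid_data P \<longleftrightarrow>
     t_init P < t_final P \<and>
     compact (input_set P) \<and>
     (\<forall>l. constraint_time P l \<in> {t_init P..t_final P}) \<and>
     constraint_fun P \<in> borel_measurable borel \<and>
     \<comment> \<open>random vector with independent components\<close>
     prob_space (xi_law P) \<and> sets (xi_law P) = sets borel \<and>
     prob_space.indep_vars (xi_law P) (\<lambda>_. borel) (\<lambda>k \<xi>. \<xi> $ k) UNIV \<and>
     \<comment> \<open>uncorrelated initial states and parameters with prescribed laws of finite variance\<close>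
     (\<forall>q. uncertain_quantity P q \<in> borel_measurable borel \<and>
          distr (xi_law P) borel (uncertain_quantity P q) = uncertain_law P q \<and>
          integrable (uncertain_law P q) (\<lambda>x. x\<^sup>2)) \<and>
     (\<forall>q q'. q \<noteq> q' \<longrightarrow>
        (\<integral>\<xi>. uncertain_quantity P q \<xi> * uncertain_quantity P q' \<xi> \<partial>xi_law P) =
        (\<integral>\<xi>. uncertain_quantity P q \<xi> \<partial>xi_law P) * (\<integral>\<xi>. uncertain_quantity P q' \<xi> \<partial>xi_law P)) \<and>
     \<comment> \<open>orthogonal polynomials\<close>
     (\<forall>m. real_polynomial_function (\<lambda>\<xi>. pce_basis P \<xi> $ m) \<and>
          integrable (xi_law P) (\<lambda>\<xi>. (pce_basis P \<xi> $ m)\<^sup>2) \<and>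
          (\<integral>\<xi>. (pce_basis P \<xi> $ m)\<^sup>2 \<partial>xi_law P) > 0) \<and>
     (\<forall>m n. m \<noteq> n \<longrightarrow> (\<integral>\<xi>. pce_basis P \<xi> $ m * pce_basis P \<xi> $ n \<partial>xi_law P) = 0)"


section \<open>Polynomial chaos expansion\<close>

text \<open>A coefficient array of type \<open>real ^ 'b ^ 'n\<close> has one row of coefficients per expanded
  quantity.\<close>

definition pce_eval ::
  "('x::finite, 'u::finite, 'p::finite, 'd::finite, 'r::finite, 'b::finite, 't::finite, 'g::finite) pce_ocp
    \<Rightarrow> real ^ 'b ^ 'n \<Rightarrow> real ^ 'r \<Rightarrow> real ^ 'n" where
  "pce_eval P C \<xi> = (\<chi> i. (C $ i) \<bullet> pce_basis P \<xi>)"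

definition pce_project ::
  "('x::finite, 'u::finite, 'p::finite, 'd::finite, 'r::finite, 'b::finite, 't::finite, 'g::finite) pce_ocp
    \<Rightarrow> (real ^ 'r \<Rightarrow> real ^ 'n) \<Rightarrow> real ^ 'b ^ 'n" where
  "pce_project P h = (\<chi> i m.
     (\<integral>\<xi>. h \<xi> $ i * pce_basis P \<xi> $ m \<partial>xi_law P) / (\<integral>\<xi>. (pce_basis P \<xi> $ m)\<^sup>2 \<partial>xi_law P))"

definition expanded_dynamics ::
  "('x::finite, 'u::finite, 'p::finite, 'd::finite, 'r::finite, 'b::finite, 't::finite, 'g::finite) pce_ocp
    \<Rightarrow> real ^ 'b ^ 'x \<Rightarrow> real ^ 'u \<Rightarrow> real ^ 'r \<Rightarrow> real ^ 'x" where
  "expanded_dynamics P C v \<xi> =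
     dynamics P (pce_eval P C \<xi>) v (pce_eval P (pce_project P (param P)) \<xi>)"

text \<open>The Bochner integral of a non-integrable function is 0, so integrability along the trajectory
  is demanded for the right-hand side to be a genuine Galerkin projection.\<close>

definition pce_trajectory ::
  "('x::finite, 'u::finite, 'p::finite, 'd::finite, 'r::finite, 'b::finite, 't::finite, 'g::finite) pce_ocp
    \<Rightarrow> real ^ 'd \<Rightarrow> (real \<Rightarrow> real ^ 'b ^ 'x) \<Rightarrow> bool" where
  "pce_trajectory P \<pi> C \<longleftrightarrow>
     C (t_init P) = pce_project P (init_state P) \<and>
     (\<forall>t\<in>{t_init P..t_final P}.
        (\<forall>i m. integrable (xi_law P)
           (\<lambda>\<xi>. expanded_dynamics P (C t) (input P t \<pi>) \<xi> $ i * pce_basis P \<xi> $ m)) \<and>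
        (C has_vector_derivative pce_project P (expanded_dynamics P (C t) (input P t \<pi>)))
          (at t within {t_init P..t_final P}))"

definition safe_set ::
  "('x::finite, 'u::finite, 'p::finite, 'd::finite, 'r::finite, 'b::finite, 't::finite, 'g::finite) pce_ocp
    \<Rightarrow> (real \<Rightarrow> real ^ 'b ^ 'x) \<Rightarrow> (real ^ 'r) set" where
  "safe_set P C =
     {\<xi>. \<forall>i. constraint_fun P (\<chi> l. pce_eval P (C (constraint_time P l)) \<xi>) $ i \<le> 0}"

definition pce_moment ::
  "('x::finite, 'u::finite, 'p::finite, 'd::finite, 'r::finite, 'b::finite, 't::finite, 'g::finite) pce_ocp
    \<Rightarrow> (real \<Rightarrow> real ^ 'b ^ 'x) \<Rightarrow> ('x \<Rightarrow> nat) \<Rightarrow> real \<Rightarrow> real" where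
  "pce_moment P C k t = (\<integral>\<xi>. (\<Prod>i\<in>UNIV. (pce_eval P (C t) \<xi> $ i) ^ k i) \<partial>xi_law P)"


section \<open>The chance constrained problem and its sample approximation\<close>

text \<open>A point of either problem is a decision vector together with the predicted coefficient
  trajectory. No regularity of the dynamics is assumed, so the trajectory need not be determined
  by the decision vector.\<close>

type_synonym ('d, 'b, 'x) pce_point = "(real ^ 'd) \<times> (real \<Rightarrow> real ^ 'b ^ 'x)"

definition unsampled_constraints ::
  "('x::finite, 'u::finite, 'p::finite, 'd::finite, 'r::finite, 'b::finite, 't::finite, 'g::finite) pce_ocp
    \<Rightarrow> real ^ 'd \<Rightarrow> (real \<Rightarrow> real ^ 'b ^ 'x) \<Rightarrow> bool" where
  "unsampled_constraints P \<pi> C \<longleftrightarrow>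
     pce_trajectory P \<pi> C \<and> (\<forall>t\<in>{t_init P..t_final P}. input P t \<pi> \<in> input_set P)"

definition chance_problem ::
  "('x::finite, 'u::finite, 'p::finite, 'd::finite, 'r::finite, 'b::finite, 't::finite, 'g::finite) pce_ocp
    \<Rightarrow> real \<Rightarrow> ('d, 'b, 'x) pce_point opt_problem" where
  "chance_problem P \<beta> =
     \<lparr> objective = (\<lambda>(\<pi>, C). cost P (\<lambda>t. input P t \<pi>) (pce_moment P C)),
       feasible_set = {(\<pi>, C). unsampled_constraints P \<pi> C \<and>
                               measure (xi_law P) (safe_set P C) \<ge> \<beta>} \<rparr>"

text \<open>The objective \<open>J\<close> of the approximated problem may depend on the samples \<open>s 1, \<dots>, s N\<close>.\<close>

definition sample_problem ::
  "('x::finite, 'u::finite, 'p::finite, 'd::finite, 'r::finite, 'b::finite, 't::finite, 'g::finite) pce_ocp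
    \<Rightarrow> ((nat \<Rightarrow> real ^ 'r) \<Rightarrow> ('d, 'b, 'x) pce_point \<Rightarrow> real)
    \<Rightarrow> real \<Rightarrow> nat \<Rightarrow> (nat \<Rightarrow> real ^ 'r)
    \<Rightarrow> ('d, 'b, 'x) pce_point opt_problem" where
  "sample_problem P J \<beta>cor N s =
     \<lparr> objective = J s,
       feasible_set = {(\<pi>, C). unsampled_constraints P \<pi> C \<and>
          (1 / real N) * (\<Sum>j=1..N. indicator (safe_set P C) (s j)) \<ge> \<beta>cor} \<rparr>"

end

theory Submission
  imports Defs
begin

text \<open>
  Fix the point and let \<open>p\<close> be the probability that the uncertainty lies in its safe set. The
  sample constraint is random only through the number of safe samples among \<open>N\<close>, which has the
  binomial distribution with success probability \<open>p\<close>. The implication in the theorem can fail only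
  if \<open>p < \<beta>\<close> while the sample constraint holds, and then at least
  \<open>k = \<lfloor>\<beta>cor N\<rfloor>\<close> samples are safe. So the task is to bound the
  binomial tail \<open>P(S \<ge> k)\<close> for every \<open>p < \<beta>\<close>. For \<open>k > N\<close> it is zero; let \<open>k \<le> N\<close>.

  The bound is the Clopper-Pearson argument. As a function of \<open>p\<close>, the tail has a derivative that is,
  by telescoping, a single term, namely the density of the Beta distribution with parameters
  \<open>k\<close> and \<open>N + 1 - k\<close> (\<open>DERIV_binomial_tail\<close>). Reflecting \<open>p\<close> to \<open>1 - p\<close> exchanges the two
  parameters, so the tail at \<open>p\<close> is one minus the distribution function of Beta(\<open>N + 1 - k\<close>, \<open>k\<close>)
  at \<open>1 - p\<close> (\<open>cdf_beta_distribution\<close>). The positive derivative makes the distribution function a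
  bijection of the unit interval, hence \<open>betainv\<close> is a genuine inverse: for
  \<open>b = betainv (1 - \<alpha>/2) (N + 1 - k) k\<close>, the tail at \<open>1 - b\<close> equals \<open>\<alpha>/2\<close>
  (\<open>betainv_binomial_tail\<close>). The choice of \<open>\<beta>cor\<close> says \<open>\<beta> \<le> 1 - b\<close>, and the tail is increasing in
  \<open>p\<close>, so for \<open>p < \<beta>\<close> it stays below \<open>\<alpha>/2\<close>, and the implication fails with probability less than
  \<open>\<alpha>\<close>.
\<close>

section \<open>The binomial tail as a function of the success probability\<close>

definition binomial_tail :: "nat \<Rightarrow> nat \<Rightarrow> real \<Rightarrow> real" where
  "binomial_tail n k p = (\<Sum>i=k..n. real (n choose i) * p ^ i * (1 - p) ^ (n - i))"

text \<open>For \<open>0 < k \<le> n\<close> and \<open>0 < p < 1\<close> this is the Beta density with parameters \<open>k\<close> and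
  \<open>n + 1 - k\<close>. It is written with a binomial coefficient so that neighbouring \<open>k\<close> telescope.\<close>

definition binomial_tail_deriv :: "nat \<Rightarrow> nat \<Rightarrow> real \<Rightarrow> real" where
  "binomial_tail_deriv n k p = real k * real (n choose k) * p ^ (k - 1) * (1 - p) ^ (n - k)"

text \<open>By the product rule, the derivative of the term at \<open>i\<close> is a difference of consecutive values
  of \<open>binomial_tail_deriv\<close>, so the sum collapses to its first value; the value
  past the end contains \<open>n choose (n + 1) = 0\<close>.\<close>

lemma DERIV_binomial_tail:
  assumes "k \<le> n"
  shows "(binomial_tail n k has_real_derivative binomial_tail_deriv n k p) (at p)"
proof -
  have term_deriv: "((\<lambda>p. real (n choose i) * p ^ i * (1 - p) ^ (n - i)) has_real_derivative
      binomial_tail_deriv n i p - binomial_tail_deriv n (Suc i) p) (at p)" for i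
  proof -
    have absorb: "real (Suc i) * real (n choose Suc i) = real (n - i) * real (n choose i)"
      by (metis binomial_absorption binomial_absorb_comp of_nat_mult)
    have "((\<lambda>p. real (n choose i) * p ^ i * (1 - p) ^ (n - i)) has_real_derivative
        real (n choose i) * (real i * p ^ (i - 1)) * (1 - p) ^ (n - i)
        - real (n - i) * real (n choose i) * p ^ i * (1 - p) ^ (n - i - 1)) (at p)"
      by (auto intro!: derivative_eq_intros simp: algebra_simps)
    also have "real (n choose i) * (real i * p ^ (i - 1)) * (1 - p) ^ (n - i)
        - real (n - i) * real (n choose i) * p ^ i * (1 - p) ^ (n - i - 1)
        = binomial_tail_deriv n i p - binomial_tail_deriv n (Suc i) p"
      unfolding binomial_tail_deriv_def absorb by simp
    finally show ?thesis .
  qed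
  have "(binomial_tail n k has_real_derivative
      (\<Sum>i=k..n. binomial_tail_deriv n i p - binomial_tail_deriv n (Suc i) p)) (at p)"
    unfolding binomial_tail_def by (intro DERIV_sum term_deriv)
  also have "(\<Sum>i=k..n. binomial_tail_deriv n i p - binomial_tail_deriv n (Suc i) p)
      = binomial_tail_deriv n k p"
    using sum_Suc_diff[of k n "\<lambda>i. - binomial_tail_deriv n i p"] assms
    by (simp add: binomial_tail_deriv_def)
  finally show ?thesis .
qed

lemma binomial_tail_0: "0 < k \<Longrightarrow> binomial_tail n k 0 = 0"
  by (auto simp: binomial_tail_def intro!: sum.neutral)

lemma binomial_tail_1: "k \<le> n \<Longrightarrow> binomial_tail n k 1 = 1"
  by (subst binomial_tail_def, subst sum.remove[of _ n]) (auto intro!: sum.neutral)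

lemma strict_mono_on_binomial_tail:
  assumes k: "0 < k" "k \<le> n"
  shows "strict_mono_on {0..1} (binomial_tail n k)"
proof (rule strict_mono_onI)
  fix p q :: real assume pq: "p \<in> {0..1}" "q \<in> {0..1}" "p < q"
  show "binomial_tail n k p < binomial_tail n k q"
  proof (rule DERIV_pos_imp_increasing_open[OF pq(3)])
    fix x assume "p < x" "x < q"
    then have "0 < binomial_tail_deriv n k x"
      using pq k by (simp add: binomial_tail_deriv_def)
    then show "\<exists>y. DERIV (binomial_tail n k) x :> y \<and> 0 < y"
      using DERIV_binomial_tail[OF k(2)] by blast
  next
    show "continuous_on {p..q} (binomial_tail n k)"
      using DERIV_binomial_tail[OF k(2)] DERIV_isCont continuous_at_imp_continuous_on by blast
  qed
qed

text \<open>The number of successes in independent trials is binomial. The event splits into atoms, one for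
  each possible success set \<open>T\<close>; independence makes the probability of an atom a product that
  depends on \<open>T\<close> only through its size.\<close>

lemma (in prob_space) prob_card_ge_binomial_tail:
  fixes I :: "'i set"
  assumes "finite I" and indep: "indep_vars (\<lambda>_. S) X I" and A: "A \<in> sets S"
    and p: "\<And>i. i \<in> I \<Longrightarrow> prob (X i -` A \<inter> space M) = p"
  shows "{\<omega> \<in> space M. k \<le> card {i \<in> I. X i \<omega> \<in> A}} \<in> events" (is "?E \<in> _")
    and "prob {\<omega> \<in> space M. k \<le> card {i \<in> I. X i \<omega> \<in> A}} = binomial_tail (card I) k p"
proof -
  have X: "X i \<in> measurable M S" if "i \<in> I" for i
    using indep that by (auto simp: indep_vars_def)
  define E where "E T = {\<omega> \<in> space M. {i \<in> I. X i \<omega> \<in> A} = T}" for T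
  define side where "side T i = (if i \<in> T then A else space S - A)" for T :: "'i set" and i
  have side: "side T i \<in> sets S" for T i
    using A by (auto simp: side_def)
  have prob_side: "prob (X i -` side T i \<inter> space M) = (if i \<in> T then p else 1 - p)"
    if "i \<in> I" for T i
  proof (cases "i \<in> T")
    case False
    have "X i -` (space S - A) \<inter> space M = space M - (X i -` A \<inter> space M)"
      using measurable_space[OF X[OF that]] by auto
    then show ?thesis
      using False p[OF that] prob_compl[OF measurable_sets[OF X[OF that] A]]
      by (simp add: side_def)
  qed (simp add: side_def p that)
  have E: "E T \<in> events \<and> prob (E T) = p ^ card T * (1 - p) ^ (card I - card T)"
    if T: "T \<subseteq> I" for T
  proof (cases "I = {}")
    case True
    then have "E T = space M" using T by (auto simp: E_def)
    then show ?thesis using True T by (simp add: prob_space)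
  next
    case False
    have "X i \<omega> \<in> side T i \<longleftrightarrow> (X i \<omega> \<in> A \<longleftrightarrow> i \<in> T)" if "i \<in> I" "\<omega> \<in> space M" for i \<omega>
      using measurable_space[OF X[OF that(1)] that(2)] by (simp add: side_def)
    then have E_eq: "E T = (\<Inter>i\<in>I. X i -` side T i \<inter> space M)"
      using False T by (auto simp: E_def)
    have "prob (E T) = (\<Prod>i\<in>I. if i \<in> T then p else 1 - p)"
      unfolding E_eq using indep_varsD_finite[OF indep False \<open>finite I\<close> side] prob_side by simp
    also have "\<dots> = p ^ card T * (1 - p) ^ card (I - T)"
      using T \<open>finite I\<close> by (simp add: prod.If_cases Int_absorb1 Diff_eq)
    finally have "prob (E T) = p ^ card T * (1 - p) ^ (card I - card T)"
      using T \<open>finite I\<close> by (simp add: card_Diff_subset finite_subset)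
    moreover have "E T \<in> events"
      unfolding E_eq using \<open>finite I\<close> False
      by (rule sets.finite_INT) (rule measurable_sets[OF X side])
    ultimately show ?thesis by simp
  qed
  define \<T> where "\<T> = {T. T \<subseteq> I \<and> k \<le> card T}"
  have fin: "finite \<T>" using \<open>finite I\<close> by (simp add: \<T>_def)
  have E_Un: "?E = (\<Union>T\<in>\<T>. E T)"
    by (auto simp: E_def \<T>_def)
  show "?E \<in> events"
    unfolding E_Un using fin E by (intro sets.finite_UN) (auto simp: \<T>_def)
  have "prob ?E = (\<Sum>T\<in>\<T>. prob (E T))"
    unfolding E_Un using fin E
    by (intro finite_measure_finite_Union) (auto simp: \<T>_def disjoint_family_on_def E_def)
  also have "\<dots> = (\<Sum>T\<in>\<T>. p ^ card T * (1 - p) ^ (card I - card T))"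
    using E by (intro sum.cong) (auto simp: \<T>_def)
  also have "\<dots> = (\<Sum>i=k..card I. \<Sum>T | T \<in> \<T> \<and> card T = i. p ^ card T * (1 - p) ^ (card I - card T))"
    using fin \<open>finite I\<close> by (intro sum.group[symmetric]) (auto simp: \<T>_def card_mono)
  also have "\<dots> = binomial_tail (card I) k p"
    unfolding binomial_tail_def
  proof (intro sum.cong refl)
    fix i assume i: "i \<in> {k..card I}"
    have "{T. T \<in> \<T> \<and> card T = i} = {T. T \<subseteq> I \<and> card T = i}"
      using i by (auto simp: \<T>_def)
    then show "(\<Sum>T | T \<in> \<T> \<and> card T = i. p ^ card T * (1 - p) ^ (card I - card T))
        = real (card I choose i) * p ^ i * (1 - p) ^ (card I - i)"
      using n_subsets[OF \<open>finite I\<close>, of i] by simp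
  qed
  finally show "prob ?E = binomial_tail (card I) k p" .
qed


section \<open>The Beta distribution with integer parameters\<close>

lemma beta_density_eq_binomial_tail_deriv:
  assumes k: "0 < k" "k \<le> n" and x: "0 < x" "x < 1"
  shows "beta_density (real n + 1 - real k) (real k) x = binomial_tail_deriv n k (1 - x)"
proof -
  have "Beta (real n + 1 - real k) (real k) = fact (n - k) * fact (k - 1) / fact n"
    using Gamma_fact[of "n - k", where 'a = real] Gamma_fact[of "k - 1", where 'a = real]
      Gamma_fact[of n, where 'a = real] k
    by (simp add: Beta_def of_nat_diff algebra_simps)
  also have "\<dots> = 1 / (real k * real (n choose k))"
    using k by (simp add: binomial_fact fact_reduce[of k])
  finally have B: "Beta (real n + 1 - real k) (real k) = 1 / (real k * real (n choose k))" .
  have "x powr (real n + 1 - real k - 1) = x ^ (n - k)"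
    using k x by (subst powr_realpow[symmetric]) (auto simp: of_nat_diff)
  moreover have "(1 - x) powr (real k - 1) = (1 - x) ^ (k - 1)"
    using k x by (subst powr_realpow[symmetric]) (auto simp: of_nat_diff)
  ultimately show ?thesis
    using x by (simp add: beta_density_def B binomial_tail_deriv_def)
qed

text \<open>The Beta density is the derivative of \<open>\<lambda>x. - binomial_tail n k (1 - x)\<close> inside the unit
  interval. At the end points the two integrands may differ, because the density is \<open>0\<close> there and the
  polynomial need not be; this is a null set.\<close>

lemma cdf_beta_distribution:
  assumes k: "0 < k" "k \<le> n" and x: "0 \<le> x" "x \<le> 1"
  shows "cdf (beta_distribution (real n + 1 - real k) (real k)) x = 1 - binomial_tail n k (1 - x)"
proof -
  let ?d = "beta_density (real n + 1 - real k) (real k)"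
  have [measurable]: "?d \<in> borel_measurable borel"
    unfolding beta_density_def by measurable
  have [measurable]: "binomial_tail_deriv n k \<in> borel_measurable borel"
    unfolding binomial_tail_deriv_def by measurable
  have "emeasure (beta_distribution (real n + 1 - real k) (real k)) {..x}
      = (\<integral>\<^sup>+y. ennreal (?d y) * indicator {..x} y \<partial>lborel)"
    unfolding beta_distribution_def by (subst emeasure_density) auto
  also have "\<dots> = (\<integral>\<^sup>+y. ennreal (binomial_tail_deriv n k (1 - y)) * indicator {0..x} y \<partial>lborel)"
  proof (rule nn_integral_cong_AE)
    have "AE y in lborel. y \<noteq> (0::real)" "AE y in lborel. y \<noteq> (1::real)"
      by (rule AE_lborel_singleton)+
    then show "AE y in lborel. ennreal (?d y) * indicator {..x} y
        = ennreal (binomial_tail_deriv n k (1 - y)) * indicator {0..x} y"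
    proof eventually_elim
      case (elim y)
      then show ?case
        using beta_density_eq_binomial_tail_deriv[OF k, of y] x
        by (cases "0 < y \<and> y < 1") (auto simp: indicator_def beta_density_def)
    qed
  qed
  also have "\<dots> = ennreal (- binomial_tail n k (1 - x) - (- binomial_tail n k (1 - 0)))"
  proof (rule nn_integral_FTC_Icc)
    fix y
    show "((\<lambda>y. - binomial_tail n k (1 - y)) has_real_derivative
        binomial_tail_deriv n k (1 - y)) (at y)"
      using DERIV_minus[OF DERIV_chain2[OF DERIV_binomial_tail[OF k(2)]
            DERIV_diff[OF DERIV_const[of 1] DERIV_ident]]] by simp
  qed (use x in \<open>auto simp: binomial_tail_deriv_def\<close>)
  finally have *: "emeasure (beta_distribution (real n + 1 - real k) (real k)) {..x}
      = ennreal (1 - binomial_tail n k (1 - x))"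
    by (simp add: binomial_tail_1 k)
  have "binomial_tail n k (1 - x) \<le> binomial_tail n k 1"
    using x by (intro strict_mono_on_leD[OF strict_mono_on_binomial_tail[OF k]]) auto
  then show ?thesis
    using * k by (simp add: cdf_def measure_def binomial_tail_1)
qed

text \<open>The inverse in \<open>betainv\<close> is defined by description, so it says something only once the
  distribution function is known to be injective on the unit interval (the tail is strictly
  monotone) and to attain the requested value (intermediate value theorem).\<close>

lemma betainv_binomial_tail:
  assumes k: "0 < k" "k \<le> n" and q: "0 \<le> q" "q \<le> 1"
  defines "b \<equiv> betainv (1 - q) (real n + 1 - real k) (real k)"
  shows "0 \<le> b" "b \<le> 1" "binomial_tail n k (1 - b) = q"
proof -
  let ?F = "cdf (beta_distribution (real n + 1 - real k) (real k))"
  have F: "?F x = 1 - binomial_tail n k (1 - x)" if "x \<in> {0..1}" for x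
    using cdf_beta_distribution[OF k] that by simp
  have inj: "inj_on ?F {0..1}"
  proof (rule inj_onI)
    fix x y :: real assume xy: "x \<in> {0..1}" "y \<in> {0..1}" and "?F x = ?F y"
    then have "binomial_tail n k (1 - x) = binomial_tail n k (1 - y)"
      by (simp add: F)
    then have "1 - x = 1 - y"
      using strict_mono_on_imp_inj_on[OF strict_mono_on_binomial_tail[OF k]] xy
      by (auto dest!: inj_onD)
    then show "x = y" by simp
  qed
  obtain x where x: "0 \<le> x" "x \<le> 1" "binomial_tail n k x = q"
    using IVT[of "binomial_tail n k" 0 q 1] DERIV_isCont[OF DERIV_binomial_tail[OF k(2)]] q k
    by (auto simp: binomial_tail_0 binomial_tail_1)
  have im: "1 - q \<in> ?F ` {0..1}"
    using x by (intro image_eqI[of _ _ "1 - x"]) (auto simp: F)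
  have b: "b \<in> {0..1}"
    unfolding b_def betainv_def by (rule the_inv_into_into[OF inj im]) simp
  then show "0 \<le> b" "b \<le> 1" by auto
  have "?F b = 1 - q"
    unfolding b_def betainv_def by (rule f_the_inv_into_f[OF inj im])
  then show "binomial_tail n k (1 - b) = q"
    using b by (simp add: F)
qed


section \<open>Confidence of the sample approximation\<close>

text \<open>The polynomial basis makes the predicted states continuous in the uncertainty, and the
  constraint functions are Borel.\<close>

lemma sets_safe_set:
  assumes "valid_data P"
  shows "safe_set P C \<in> sets borel"
proof -
  have "continuous_on UNIV (\<lambda>\<xi>. pce_basis P \<xi> $ m)" for m
    using assms unfolding valid_data_def
    by (intro continuous_at_imp_continuous_on ballI continuous_real_polymonial_function) auto
  then have "continuous_on UNIV (pce_basis P)"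
    using continuous_on_vec_lambda[of UNIV "\<lambda>m \<xi>. pce_basis P \<xi> $ m"] by simp
  then have "continuous_on UNIV (\<lambda>\<xi>. \<chi> l. pce_eval P (C (constraint_time P l)) \<xi>)"
    unfolding pce_eval_def by (intro continuous_intros)
  then have "(\<lambda>\<xi>. \<chi> l. pce_eval P (C (constraint_time P l)) \<xi>) \<in> borel_measurable borel"
    by (rule borel_measurable_continuous_onI)
  moreover have "constraint_fun P \<in> borel_measurable borel"
    using assms by (simp add: valid_data_def)
  ultimately have meas: "(\<lambda>\<xi>. constraint_fun P (\<chi> l. pce_eval P (C (constraint_time P l)) \<xi>))
      \<in> borel_measurable borel"
    by (rule measurable_compose)
  have "closed {y. \<forall>i. y $ i \<le> (0::real)}"
    by (intro closed_Collect_all closed_Collect_le continuous_intros)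
  then have "{y. \<forall>i. y $ i \<le> (0::real)} \<in> sets borel"
    by (rule borel_closed)
  from measurable_sets_borel[OF meas this] show ?thesis
    by (simp add: safe_set_def vimage_def)
qed

theorem theorem2:
  fixes P :: "('x::finite, 'u::finite, 'p::finite, 'd::finite, 'r::finite, 'b::finite,
               't::finite, 'g::finite) pce_ocp"
    and M :: "'w measure"
    and \<xi>s :: "nat \<Rightarrow> 'w \<Rightarrow> real ^ 'r"
    and J :: "(nat \<Rightarrow> real ^ 'r) \<Rightarrow> ('d, 'b, 'x) pce_point \<Rightarrow> real"
    and \<pi>' :: "real ^ 'd"
    and C' :: "real \<Rightarrow> real ^ 'b ^ 'x"
    and \<alpha> \<beta> \<beta>cor :: real
    and N :: nat
  assumes data: "valid_data P"
    and alpha: "0 < \<alpha>" "\<alpha> < 1"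
    and beta: "0 < \<beta>" "\<beta> \<le> 1"
    and prob: "prob_space M"
    and indep: "prob_space.indep_vars M (\<lambda>_. borel) \<xi>s {1..N}"
    and ident: "\<And>j. j \<in> {1..N} \<Longrightarrow> distr M borel (\<xi>s j) = xi_law P"
    and beta_cor: "\<beta> < \<beta>cor"
    and betainv_defined: "0 < \<lfloor>\<beta>cor * real N\<rfloor>"
    and choice: "1 - betainv (1 - \<alpha> / 2)
                       (real N + 1 - of_int \<lfloor>\<beta>cor * real N\<rfloor>)
                       (of_int \<lfloor>\<beta>cor * real N\<rfloor>) \<ge> \<beta>"
  shows "measure M {\<omega> \<in> space M.
           (\<pi>', C') \<in> feasible_set (sample_problem P J \<beta>cor N (\<lambda>j. \<xi>s j \<omega>)) \<longrightarrow>
           (\<pi>', C') \<in> feasible_set (chance_problem P \<beta>)} \<ge> 1 - \<alpha>"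
    (is "measure M ?good \<ge> _")
proof -
  interpret M: prob_space M by (rule prob)
  define A where "A = safe_set P C'"
  define p where "p = measure (xi_law P) A"
  define k where "k = nat \<lfloor>\<beta>cor * real N\<rfloor>"
  define E where "E = {\<omega> \<in> space M. k \<le> card {j \<in> {1..N}. \<xi>s j \<omega> \<in> A}}"
  have k: "0 < k" and k_floor: "\<lfloor>\<beta>cor * real N\<rfloor> = int k"
    using betainv_defined by (auto simp: k_def)
  have N: "0 < N"
    using betainv_defined by (cases N) auto
  have A: "A \<in> sets borel"
    unfolding A_def by (rule sets_safe_set[OF data])
  have prob_in_A: "M.prob (\<xi>s j -` A \<inter> space M) = p" if "j \<in> {1..N}" for j
  proof -
    have "\<xi>s j \<in> borel_measurable M"
      using indep that by (auto simp: M.indep_vars_def)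
    then show ?thesis
      unfolding p_def ident[OF that, symmetric] using A by (simp add: measure_distr)
  qed
  have E: "E \<in> M.events"
    unfolding E_def by (rule M.prob_card_ge_binomial_tail(1)[OF _ indep A prob_in_A]) simp_all
  have prob_E: "M.prob E = binomial_tail N k p"
    unfolding E_def by (subst M.prob_card_ge_binomial_tail(2)[OF _ indep A prob_in_A]) simp_all
  (* If the deterministic constraints fail, the premise of the implication is false for every
     outcome; if they hold together with the chance constraint, its conclusion is true. *)
  show ?thesis
  proof (cases "unsampled_constraints P \<pi>' C' \<longrightarrow> \<beta> \<le> p")
    case True
    then have "?good = space M"
      by (auto simp: sample_problem_def chance_problem_def p_def A_def)
    then show ?thesis using alpha by (simp add: M.prob_space)
  next
    case False
    then have good_eq: "?good =
        {\<omega> \<in> space M. \<not> \<beta>cor \<le> 1 / real N * (\<Sum>j=1..N. indicator A (\<xi>s j \<omega>))}"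
      by (auto simp: sample_problem_def chance_problem_def A_def p_def)
    have "k \<le> card {j \<in> {1..N}. \<xi>s j \<omega> \<in> A}"
      if "\<beta>cor \<le> 1 / real N * (\<Sum>j=1..N. indicator A (\<xi>s j \<omega>))" for \<omega>
    proof -
      have "real k \<le> \<beta>cor * real N"
        using of_int_floor_le[of "\<beta>cor * real N"] k_floor by simp
      also have "\<dots> \<le> (\<Sum>j=1..N. indicator A (\<xi>s j \<omega>))"
        using that N by (simp add: field_simps)
      also have "\<dots> = real (card {j \<in> {1..N}. \<xi>s j \<omega> \<in> A})"
        by (simp add: indicator_def sum.If_cases Int_def)
      finally show ?thesis by simp
    qed
    then have sub: "space M - E \<subseteq> ?good"
      unfolding good_eq E_def by blast
    have good_event: "?good \<in> M.events"
    proof -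
      have [measurable]: "A \<in> sets borel" by (rule A)
      have [measurable]: "\<xi>s j \<in> borel_measurable M" if "j \<in> {1..N}" for j
        using indep that by (auto simp: M.indep_vars_def)
      show ?thesis unfolding good_eq by measurable
    qed
    have "M.prob E \<le> \<alpha> / 2"
    proof (cases "k \<le> N")
      (* For \<beta>cor > 1 the required count may exceed N; then E is impossible and the parameters of
         betainv are out of range. *)
      case False
      then show ?thesis using alpha by (simp add: prob_E binomial_tail_def)
    next
      case True
      let ?b = "betainv (1 - \<alpha> / 2) (real N + 1 - real k) (real k)"
      have b: "0 \<le> ?b" "?b \<le> 1" "binomial_tail N k (1 - ?b) = \<alpha> / 2"
        using betainv_binomial_tail[OF k True, of "\<alpha> / 2"] alpha by auto
      have "0 \<le> p" by (simp add: p_def)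
      moreover have "p < 1 - ?b"
        using choice \<open>\<not> (unsampled_constraints P \<pi>' C' \<longrightarrow> \<beta> \<le> p)\<close> by (simp add: k_floor)
      ultimately have "binomial_tail N k p < binomial_tail N k (1 - ?b)"
        using b by (intro strict_mono_onD[OF strict_mono_on_binomial_tail[OF k True]]) auto
      then show ?thesis using b by (simp add: prob_E)
    qed
    moreover have "M.prob (space M - E) \<le> M.prob ?good"
      using sub good_event by (rule M.finite_measure_mono)
    ultimately show ?thesis
      using M.prob_compl[OF E] alpha by simp
  qed
qed

end
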